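(* Let $n\ge1$, let $0=b_0<b_1<\cdots<b_n<b_{n+1}=1$, let $a,r\in L^\infty(I)$, $I=(0,1)$, with $a\ge a_0>0$ and $r\ge r_0\ge 0$ a.e. for constants $a_0,r_0$, and let $\gamma>0$, $\alpha,\beta\in\mathbb R$ and $f$ be given. The system of linear equations $$\mathcal A(\mathbf b)\,\mathbf c=\mathcal F(\mathbf b),\qquad \mathcal A(\mathbf b)=A_a(\mathbf b)+M_r(\mathbf b)+\gamma\,\mathbf d\mathbf d^T,\qquad \mathcal F(\mathbf b)=\mathbf f(\mathbf b)+\gamma(\beta-\alpha)\mathbf d,$$ for the unknown $\mathbf c\in\mathbb R^{n+1}$ can be solved in $\mathcal O(n)$ arithmetic operations.
   Context: $\sigma(t)=\max\{0,t\}$; $H$ is the Heaviside function ($H(t)=1$ for $t>0$, $H(0)=\tfrac12$, $H(t)=0$ for $t<0$); $\mathbf b=(b_1,\dots,b_n)^T$. For $i,j=1,\dots,n+1$: $M_r(\mathbf b)$ has entries $\int_0^1 r(x)\sigma(x-b_{i-1})\sigma(x-b_{j-1})\,dx$; $A_a(\mathbf b)$ has entries $\int_0^1 a(x)H(x-b_{i-1})H(x-b_{j-1})\,dx$; $\mathbf f(\mathbf b)$ has entries $\int_0^1\left(f(x)-\alpha r(x)\right)\sigma(x-b_{i-1})\,dx$. The vector $\mathbf d=\nabla_{\mathbf c}u_n(1)=(1-b_0,1-b_1,\dots,1-b_n)^T$, where $u_n(x)=\alpha+c_0x+\sum_{i=1}^n c_i\sigma(x-b_i)$ and $\mathbf c=(c_0,\dots,c_n)^T$.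 The operation count is for exact real arithmetic, with the breakpoints, the entries of the right-hand side, and the element integrals $\int_{b_i}^{b_{i+1}}a(x)\,dx$ and $\int_{b_i}^{b_{i+1}}r(x)(x-b_i)^k\,dx$ ($k=0,1,2$; $i=0,\dots,n$) regarded as given data; the constant in $\mathcal O(n)$ is independent of $n$ and of the data. *)

theory Defs
  imports
    "HOL-Analysis.Analysis"
    "HOL-Library.Monad_Syntax"
    "Jordan_Normal_Form.Matrix"
begin

section \<open>The linear system\<close>

definition relu :: "real \<Rightarrow> real" where
  "relu t = max 0 t"

definition heaviside :: "real \<Rightarrow> real" where
  "heaviside t = (if t > 0 then 1 else if t = 0 then 1/2 else 0)"

abbreviation unit_interval :: "real set" where
  "unit_interval \<equiv> {0<..<1}"

definition L_infinity :: "real set \<Rightarrow> (real \<Rightarrow> real) \<Rightarrow> bool" where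
  "L_infinity S g \<longleftrightarrow> set_borel_measurable lebesgue S g \<and>
     (\<exists>K. AE x\<in>S in lebesgue. \<bar>g x\<bar> \<le> K)"

text \<open>
  Rows and columns are numbered from 0 to n, so index \<open>i\<close> below belongs to the basis function
  \<open>\<sigma>(x - b\<^sub>i)\<close>. The breakpoints are given by a sequence of which only the values
  at \<open>0, \<dots>, n + 1\<close> matter.
\<close>

definition mass_matrix :: "nat \<Rightarrow> (nat \<Rightarrow> real) \<Rightarrow> (real \<Rightarrow> real) \<Rightarrow> real mat" where
  "mass_matrix n b r = Matrix.mat (n+1) (n+1) (\<lambda>(i, j).
     LINT x:unit_interval|lebesgue. r x * relu (x - b i) * relu (x - b j))"

definition stiffness_matrix :: "nat \<Rightarrow> (nat \<Rightarrow> real) \<Rightarrow> (real \<Rightarrow> real) \<Rightarrow> real mat" where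
  "stiffness_matrix n b a = Matrix.mat (n+1) (n+1) (\<lambda>(i, j).
     LINT x:unit_interval|lebesgue. a x * heaviside (x - b i) * heaviside (x - b j))"

definition load_vector ::
    "nat \<Rightarrow> (nat \<Rightarrow> real) \<Rightarrow> (real \<Rightarrow> real) \<Rightarrow> (real \<Rightarrow> real) \<Rightarrow> real \<Rightarrow> real Matrix.vec" where
  "load_vector n b r f \<alpha> = Matrix.vec (n+1) (\<lambda>i.
     LINT x:unit_interval|lebesgue. (f x - \<alpha> * r x) * relu (x - b i))"

definition d_vector :: "nat \<Rightarrow> (nat \<Rightarrow> real) \<Rightarrow> real Matrix.vec" where
  "d_vector n b = Matrix.vec (n+1) (\<lambda>i. 1 - b i)"

definition outer_product :: "real Matrix.vec \<Rightarrow> real Matrix.vec \<Rightarrow> real mat" where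
  "outer_product v w =
     Matrix.mat (dim_vec v) (dim_vec w) (\<lambda>(i, j). vec_index v i * vec_index w j)"

definition system_matrix ::
    "nat \<Rightarrow> (nat \<Rightarrow> real) \<Rightarrow> (real \<Rightarrow> real) \<Rightarrow> (real \<Rightarrow> real) \<Rightarrow> real \<Rightarrow> real mat" where
  "system_matrix n b a r \<gamma> =
     stiffness_matrix n b a + mass_matrix n b r
     + \<gamma> \<cdot>\<^sub>m outer_product (d_vector n b) (d_vector n b)"

definition system_rhs ::
    "nat \<Rightarrow> (nat \<Rightarrow> real) \<Rightarrow> (real \<Rightarrow> real) \<Rightarrow> (real \<Rightarrow> real) \<Rightarrow> real \<Rightarrow> real \<Rightarrow> real \<Rightarrow> real Matrix.vec" where
  "system_rhs n b r f \<gamma> \<alpha> \<beta> =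
     load_vector n b r f \<alpha> + (\<gamma> * (\<beta> - \<alpha>)) \<cdot>\<^sub>v d_vector n b"

section \<open>Algorithms in exact real arithmetic\<close>

text \<open>
  The model is a real-number machine whose memory consists of named arrays of reals. Its control
  flow (array indices and loop bounds) is computed from index variables alone and never depends
  on the stored reals. Only integer constants may be written in a program. A division by zero aborts
  the computation. The cost is the number of real operations \<open>+, -, *, /\<close> executed.
\<close>

datatype iexp =
    INum nat
  | IVar string
  | IAdd iexp iexp
  | ISub iexp iexp  \<comment> \<open>truncated at 0\<close>

datatype rexp =
    Const int
  | Arr string iexp
  | Add rexp rexp
  | Sub rexp rexp
  | Mul rexp rexp
  | Div rexp rexp

text \<open>\<open>For v lo hi c\<close> runs \<open>c\<close> with \<open>v = lo, lo + 1, \<dots>, hi - 1\<close>.\<close>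

datatype cmd =
    Assign string iexp rexp
  | Seq cmd cmd
  | For string iexp iexp cmd

type_synonym env = "string \<Rightarrow> nat"
type_synonym store = "string \<Rightarrow> nat \<Rightarrow> real"

primrec ival :: "iexp \<Rightarrow> env \<Rightarrow> nat" where
  "ival (INum k) \<eta> = k"
| "ival (IVar v) \<eta> = \<eta> v"
| "ival (IAdd p q) \<eta> = ival p \<eta> + ival q \<eta>"
| "ival (ISub p q) \<eta> = ival p \<eta> - ival q \<eta>"

primrec rval :: "rexp \<Rightarrow> env \<Rightarrow> store \<Rightarrow> real option" where
  "rval (Const k) \<eta> s = Some (of_int k)"
| "rval (Arr x p) \<eta> s = Some (s x (ival p \<eta>))"
| "rval (Add d e) \<eta> s = do { u \<leftarrow> rval d \<eta> s; v \<leftarrow> rval e \<eta> s; Some (u + v) }"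
| "rval (Sub d e) \<eta> s = do { u \<leftarrow> rval d \<eta> s; v \<leftarrow> rval e \<eta> s; Some (u - v) }"
| "rval (Mul d e) \<eta> s = do { u \<leftarrow> rval d \<eta> s; v \<leftarrow> rval e \<eta> s; Some (u * v) }"
| "rval (Div d e) \<eta> s =
     do { u \<leftarrow> rval d \<eta> s; v \<leftarrow> rval e \<eta> s; if v = 0 then None else Some (u / v) }"

primrec ops :: "rexp \<Rightarrow> nat" where
  "ops (Const k) = 0"
| "ops (Arr x p) = 0"
| "ops (Add d e) = ops d + ops e + 1"
| "ops (Sub d e) = ops d + ops e + 1"
| "ops (Mul d e) = ops d + ops e + 1"
| "ops (Div d e) = ops d + ops e + 1"

primrec iterate ::
    "(nat \<Rightarrow> store \<Rightarrow> (store \<times> nat) option) \<Rightarrow> nat list \<Rightarrow> store \<Rightarrow> (store \<times> nat) option" where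
  "iterate g [] s = Some (s, 0)"
| "iterate g (k # ks) s =
     do { (s1, t1) \<leftarrow> g k s; (s2, t2) \<leftarrow> iterate g ks s1; Some (s2, t1 + t2) }"

text \<open>The result is the final store together with the number of real operations executed.\<close>

primrec exec :: "cmd \<Rightarrow> env \<Rightarrow> store \<Rightarrow> (store \<times> nat) option" where
  "exec (Assign x p e) \<eta> s =
     do { v \<leftarrow> rval e \<eta> s; Some (s(x := (s x)(ival p \<eta> := v)), ops e) }"
| "exec (Seq c1 c2) \<eta> s =
     do { (s1, t1) \<leftarrow> exec c1 \<eta> s; (s2, t2) \<leftarrow> exec c2 \<eta> s1; Some (s2, t1 + t2) }"
| "exec (For v lo hi c) \<eta> s =
     iterate (\<lambda>k. exec c (\<eta>(v := k))) [ival lo \<eta>..<ival hi \<eta>] s"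

section \<open>The given data\<close>

definition element_integral ::
    "(nat \<Rightarrow> real) \<Rightarrow> nat \<Rightarrow> (real \<Rightarrow> real) \<Rightarrow> real" where
  "element_integral b i g = (LINT x:{b i<..<b (i+1)}|lebesgue. g x)"

text \<open>
  Initially array \<open>b\<close> holds the breakpoints, \<open>F\<close> the right-hand side, \<open>a\<close> the element integrals of
  the function \<open>a\<close>, \<open>r0\<close>, \<open>r1\<close>, \<open>r2\<close> the element moments of \<open>r\<close>, and cell 0 of array \<open>gamma\<close> the
  penalty parameter; all other cells hold 0.
\<close>

definition input_env :: "nat \<Rightarrow> env" where
  "input_env n = (\<lambda>v. if v = ''n'' then n else 0)"

definition input_store ::
    "nat \<Rightarrow> (nat \<Rightarrow> real) \<Rightarrow> (real \<Rightarrow> real) \<Rightarrow> (real \<Rightarrow> real) \<Rightarrow> real \<Rightarrow> real Matrix.vec \<Rightarrow> store" where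
  "input_store n b a r \<gamma> F = (\<lambda>x i.
     if x = ''b'' \<and> i \<le> n + 1 then b i
     else if x = ''F'' \<and> i \<le> n then vec_index F i
     else if x = ''a'' \<and> i \<le> n then element_integral b i a
     else if x = ''r0'' \<and> i \<le> n then element_integral b i r
     else if x = ''r1'' \<and> i \<le> n then element_integral b i (\<lambda>x. r x * (x - b i))
     else if x = ''r2'' \<and> i \<le> n then element_integral b i (\<lambda>x. r x * (x - b i)\<^sup>2)
     else if x = ''gamma'' \<and> i = 0 then \<gamma>
     else 0)"

definition output_vector :: "nat \<Rightarrow> store \<Rightarrow> real Matrix.vec" where
  "output_vector n s = Matrix.vec (n+1) (s ''c'')"

end

theory Submission
  imports Defs
begin

text \<open>
  Let \<open>y\<^sub>k = u(b\<^sub>k)\<close> be the nodal values and \<open>S\<^sub>k\<close> the slope on element \<open>k\<close> of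
  \<open>u(x) = \<Sum> c\<^sub>j \<sigma>(x - b\<^sub>j)\<close>, and let \<open>\<mu>\<^sub>k\<close> be the integral of \<open>r u\<close> over \<open>(b\<^sub>k, 1)\<close> plus \<open>\<gamma> u(1)\<close>.
  Subtracting consecutive rows of the dense system turns it into a discrete Hamiltonian boundary value
  problem for \<open>(y, \<mu>)\<close>, local to the elements, with \<open>y\<^sub>0 = 0\<close> and \<open>\<mu> = \<gamma> y\<close> at the right end. The
  ansatz \<open>\<mu>\<^sub>k = s\<^sub>k y\<^sub>k + t\<^sub>k\<close> yields a backward Riccati recursion for \<open>s, t\<close>; a forward sweep
  then recovers \<open>y\<close> and the slopes, whose differences are \<open>c\<close>. No pivot vanishes: \<open>s\<^sub>k\<close> is a Schur
  complement of an energy form, so it stays nonnegative, and each pivot is at least the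
  element integral of \<open>a\<close>.
\<close>

section \<open>The sweeps\<close>

text \<open>With u affine on element \<open>i\<close>, the difference of rows \<open>i\<close> and
  \<open>i + 1\<close>, after the ansatz is inserted, reads \<open>D * slope + g * y = e\<close>;
  thus \<open>D\<close> is the pivot, \<open>g\<close> the coupling to the nodal value and
  \<open>e\<close> the reduced right-hand side. Loops only count upward, so \<open>i = n - k\<close>
  reverses the order. The length \<open>h\<close> is a spliced expression, and each of its uses is
  charged one subtraction.\<close>

definition backward_step :: cmd where
  "backward_step =
    (let i = ISub (IVar ''n'') (IVar ''k''); j = IAdd i (INum 1);
         h = Sub (Arr ''b'' j) (Arr ''b'' i)
     in Seq (Assign ''D'' i (Add (Add (Arr ''a'' i) (Arr ''r2'' i)) (Mul (Mul h h) (Arr ''s'' j))))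
       (Seq (Assign ''g'' i (Add (Arr ''r1'' i) (Mul h (Arr ''s'' j))))
       (Seq (Assign ''e'' i (Sub (Sub (Arr ''F'' i) (Arr ''F'' j)) (Mul h (Arr ''t'' j))))
       (Seq (Assign ''s'' i (Sub (Add (Arr ''s'' j) (Arr ''r0'' i))
                                 (Div (Mul (Arr ''g'' i) (Arr ''g'' i)) (Arr ''D'' i))))
            (Assign ''t'' i (Add (Arr ''t'' j)
                                 (Div (Mul (Arr ''g'' i) (Arr ''e'' i)) (Arr ''D'' i))))))))"

text \<open>The terminal condition \<mu> = \<gamma> y means \<open>s = gamma\<close> and
  \<open>t = 0\<close> at index \<open>n + 1\<close>; the latter is the default content of that
  cell. Copying \<open>gamma\<close> involves no arithmetic and costs nothing.\<close>

definition backward_sweep :: cmd where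
  "backward_sweep =
    Seq (Assign ''s'' (IAdd (IVar ''n'') (INum 1)) (Arr ''gamma'' (INum 0)))
        (For ''k'' (INum 0) (IAdd (IVar ''n'') (INum 1)) backward_step)"

text \<open>Array \<open>C\<close> is shifted by one, cell \<open>k + 1\<close> holding the slope on element \<open>k\<close>, so that the
  zero in cell 0 makes \<open>c\<^sub>0\<close> no special case.\<close>

definition forward_step :: cmd where
  "forward_step =
    (let i = IVar ''k''; j = IAdd i (INum 1); h = Sub (Arr ''b'' j) (Arr ''b'' i)
     in Seq (Assign ''C'' j (Div (Sub (Arr ''e'' i) (Mul (Arr ''g'' i) (Arr ''y'' i))) (Arr ''D'' i)))
       (Seq (Assign ''y'' j (Add (Arr ''y'' i) (Mul h (Arr ''C'' j))))
            (Assign ''c'' i (Sub (Arr ''C'' j) (Arr ''C'' i)))))"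

definition forward_sweep :: cmd where
  "forward_sweep = For ''k'' (INum 0) (IAdd (IVar ''n'') (INum 1)) forward_step"

section \<open>Execution of the sweeps: absence of aborts, exact cost, resulting relations\<close>

text \<open>A loop rule for total correctness with exact cost: every pass costs the same
  \<open>m\<close>, as no control flow depends on stored reals. The induction peels off the first
  index, following \<open>iterate\<close>.\<close>

lemma iterate_upt_invariant:
  assumes "I lo s" "lo \<le> hi"
    and step: "\<And>k s. lo \<le> k \<Longrightarrow> k < hi \<Longrightarrow> I k s \<Longrightarrow> \<exists>s'. g k s = Some (s', m) \<and> I (Suc k) s'"
  shows "\<exists>s'. iterate g [lo..<hi] s = Some (s', m * (hi - lo)) \<and> I hi s'"
  using assms
proof (induction "hi - lo" arbitrary: lo s)
  case 0
  then show ?case by simp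
next
  case (Suc d)
  then have "lo < hi" by simp
  obtain s1 where s1: "g lo s = Some (s1, m)" "I (Suc lo) s1"
    using Suc.prems(3)[of lo s] \<open>lo < hi\<close> Suc.prems(1) by auto
  obtain s2 where "iterate g [Suc lo..<hi] s1 = Some (s2, m * (hi - Suc lo))" "I hi s2"
    using Suc.hyps(1)[of "Suc lo" s1] Suc.hyps(2) s1(2) Suc.prems(3) \<open>lo < hi\<close> by force
  moreover have "m + m * (hi - Suc lo) = m * (hi - lo)"
    using \<open>lo < hi\<close> by (simp add: Suc_diff_Suc flip: mult_Suc_right)
  ultimately show ?case
    using s1(1) \<open>lo < hi\<close> by (simp add: upt_conv_Cons)
qed

text \<open>One step of the discrete Riccati recursion, as a property of a single store. Positivity
  of \<open>D\<close> is included because the forward sweep divides by it again.\<close>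

definition riccati_relations :: "store \<Rightarrow> nat \<Rightarrow> bool" where
  "riccati_relations s i \<longleftrightarrow>
    (let h = s ''b'' (Suc i) - s ''b'' i
     in s ''D'' i = s ''a'' i + s ''r2'' i + h * h * s ''s'' (Suc i) \<and>
        s ''g'' i = s ''r1'' i + h * s ''s'' (Suc i) \<and>
        s ''e'' i = s ''F'' i - s ''F'' (Suc i) - h * s ''t'' (Suc i) \<and>
        s ''s'' i = s ''s'' (Suc i) + s ''r0'' i - s ''g'' i * s ''g'' i / s ''D'' i \<and>
        s ''t'' i = s ''t'' (Suc i) + s ''g'' i * s ''e'' i / s ''D'' i \<and>
        s ''D'' i > 0)"

text \<open>The form \<open>A * z^2 + (R0 * y^2 + 2 * R1 * y * z + R2 * z^2) + s * (y + h *
  z)^2\<close> is the energy of an element plus that of everything to its right. It is nonnegative,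
  with matrix entries \<open>s + R0\<close>, \<open>g\<close>, \<open>D\<close>; eliminating the
  slope \<open>z\<close> leaves the Schur complement.\<close>

lemma schur_complement_nonneg:
  fixes A R0 R1 R2 h s :: real
  assumes A: "A > 0" and s: "s \<ge> 0"
    and psd: "\<And>y z. R0 * y\<^sup>2 + 2 * R1 * y * z + R2 * z\<^sup>2 \<ge> 0"
  shows "A + R2 + h * h * s > 0"
    and "s + R0 - (R1 + h * s) * (R1 + h * s) / (A + R2 + h * h * s) \<ge> 0"
proof -
  define D g where "D = A + R2 + h * h * s" and "g = R1 + h * s"
  show D: "A + R2 + h * h * s > 0"
    using psd[of 0 1] A s by (simp add: add_pos_nonneg)
  \<comment> \<open>The energy form evaluated at \<open>(D, - g)\<close>.\<close>
  have "D * ((s + R0) * D - g * g) =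
      s * (D - h * g)\<^sup>2 + A * g\<^sup>2 + (R0 * D\<^sup>2 + 2 * R1 * D * (- g) + R2 * (- g)\<^sup>2)"
    by (simp add: D_def g_def power2_eq_square algebra_simps)
  also have "\<dots> \<ge> 0"
    using psd[of D "- g"] A s by simp
  finally have "(s + R0) * D \<ge> g * g"
    using D by (simp add: D_def[symmetric] zero_le_mult_iff)
  then show "s + R0 - (R1 + h * s) * (R1 + h * s) / (A + R2 + h * h * s) \<ge> 0"
    using D unfolding D_def[symmetric] g_def[symmetric] by (simp add: field_simps)
qed

lemma exec_backward_sweep:
  assumes A: "\<And>i. i \<le> n \<Longrightarrow> s0 ''a'' i > 0"
    and psd: "\<And>i y z. i \<le> n \<Longrightarrow> s0 ''r0'' i * y\<^sup>2 + 2 * s0 ''r1'' i * y * z + s0 ''r2'' i * z\<^sup>2 \<ge> 0"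
    and gamma: "s0 ''gamma'' 0 \<ge> 0"
  shows "\<exists>s. exec backward_sweep (input_env n) s0 = Some (s, 20 * (n + 1)) \<and>
    (\<forall>x \<in> {''b'', ''F'', ''a'', ''r0'', ''r1'', ''r2'', ''y'', ''C''}. s x = s0 x) \<and>
    s ''s'' (n + 1) = s0 ''gamma'' 0 \<and> s ''t'' (n + 1) = s0 ''t'' (n + 1) \<and>
    (\<forall>i\<le>n. riccati_relations s i)"
proof -
  define s1 where "s1 = s0(''s'' := (s0 ''s'')(n + 1 := s0 ''gamma'' 0))"
  \<comment> \<open>After \<open>k\<close> passes the top \<open>k\<close> elements are done;
    \<open>n < i + k\<close> expresses this without truncated subtraction. Only the newest cell of
    \<open>s\<close> needs a sign, since the next pivot depends on it alone. Arrays \<open>y\<close>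
    and \<open>C\<close> are listed so that their initial zeros reach the forward sweep.\<close>
  define I where "I k s \<longleftrightarrow>
    (\<forall>x \<in> {''b'', ''F'', ''a'', ''r0'', ''r1'', ''r2'', ''y'', ''C''}. s x = s0 x) \<and>
    s ''s'' (n + 1) = s0 ''gamma'' 0 \<and> s ''t'' (n + 1) = s0 ''t'' (n + 1) \<and>
    s ''s'' (n + 1 - k) \<ge> 0 \<and>
    (\<forall>i. i \<le> n \<longrightarrow> n < i + k \<longrightarrow> riccati_relations s i)" for k s
  have init: "I 0 s1"
    using gamma by (simp add: I_def s1_def)
  have step: "\<exists>s'. exec backward_step ((input_env n)(''k'' := k)) s = Some (s', 20) \<and> I (Suc k) s'"
    if "0 \<le> k" and k: "k < n + 1" and I: "I k s" for k s
  proof -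
    define i where "i = n - k"
    have i: "i \<le> n" "n + 1 - k = Suc i" "n + 1 - Suc k = i"
      using k by (auto simp: i_def)
    define h where "h = s ''b'' (Suc i) - s ''b'' i"
    define D where "D = s ''a'' i + s ''r2'' i + h * h * s ''s'' (Suc i)"
    define g where "g = s ''r1'' i + h * s ''s'' (Suc i)"
    define e where "e = s ''F'' i - s ''F'' (Suc i) - h * s ''t'' (Suc i)"
    define \<sigma> where "\<sigma> = s ''s'' (Suc i) + s ''r0'' i - g * g / D"
    define \<tau> where "\<tau> = s ''t'' (Suc i) + g * e / D"
    have "s ''s'' (Suc i) \<ge> 0"
      using I i by (simp add: I_def)
    then have D: "D > 0" and \<sigma>: "\<sigma> \<ge> 0"
      using schur_complement_nonneg[of "s ''a'' i" "s ''s'' (Suc i)" "s ''r0'' i" "s ''r1'' i" "s ''r2'' i" h]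
        I A[OF i(1)] psd[OF i(1)]
      by (simp_all add: I_def D_def g_def \<sigma>_def)
    define s' where "s' = s(''D'' := (s ''D'')(i := D), ''g'' := (s ''g'')(i := g),
      ''e'' := (s ''e'')(i := e), ''s'' := (s ''s'')(i := \<sigma>), ''t'' := (s ''t'')(i := \<tau>))"
    have "exec backward_step ((input_env n)(''k'' := k)) s = Some (s', 20)"
      using D
      by (simp add: backward_step_def Let_def input_env_def h_def[symmetric] i_def[symmetric]
          D_def[symmetric] g_def[symmetric] e_def[symmetric] \<sigma>_def[symmetric] \<tau>_def[symmetric] s'_def)
    moreover have "riccati_relations s' i"
      using D by (simp add: riccati_relations_def Let_def s'_def D_def g_def e_def \<sigma>_def \<tau>_def h_def)
    \<comment> \<open>The pass writes only at index \<open>i\<close>, while the relations at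
      \<open>j\<close> read indices \<open>j\<close> and \<open>Suc j\<close>.\<close>
    moreover have "riccati_relations s' j" if "j > i" "riccati_relations s j" for j
      using that by (simp add: riccati_relations_def Let_def s'_def)
    moreover have "n < j + k \<longleftrightarrow> i < j" "n < j + Suc k \<longleftrightarrow> i = j \<or> i < j" for j
      using k by (auto simp: i_def)
    ultimately show ?thesis
      using I i \<sigma> by (auto simp: I_def s'_def)
  qed
  have "\<exists>s. iterate (\<lambda>k. exec backward_step ((input_env n)(''k'' := k))) [0..<n + 1] s1 =
      Some (s, 20 * (n + 1 - 0)) \<and> I (n + 1) s"
    by (rule iterate_upt_invariant[where I = I, OF init le0 step])
  then obtain s where "iterate (\<lambda>k. exec backward_step ((input_env n)(''k'' := k))) [0..<n + 1] s1 =
      Some (s, 20 * (n + 1))" "I (n + 1) s"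
    unfolding minus_nat.diff_0 by blast
  then have "exec backward_sweep (input_env n) s0 = Some (s, 20 * (n + 1))"
    by (simp add: backward_sweep_def input_env_def s1_def del: upt_Suc)
  with \<open>I (n + 1) s\<close> show ?thesis
    by (auto simp: I_def)
qed

text \<open>Positive pivots exclude an abort. Every cell of \<open>C\<close>, \<open>y\<close> and
  \<open>c\<close> is written at most once and read only afterwards, so the recurrences hold in the
  final store.\<close>

lemma exec_forward_sweep:
  assumes "\<And>i. i \<le> n \<Longrightarrow> s0 ''D'' i > 0"
  shows "\<exists>s. exec forward_sweep (input_env n) s0 = Some (s, 7 * (n + 1)) \<and>
    (\<forall>x. x \<notin> {''C'', ''y'', ''c''} \<longrightarrow> s x = s0 x) \<and>
    s ''C'' 0 = s0 ''C'' 0 \<and> s ''y'' 0 = s0 ''y'' 0 \<and>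
    (\<forall>i\<le>n. s ''C'' (Suc i) = (s ''e'' i - s ''g'' i * s ''y'' i) / s ''D'' i \<and>
      s ''y'' (Suc i) = s ''y'' i + (s ''b'' (Suc i) - s ''b'' i) * s ''C'' (Suc i) \<and>
      s ''c'' i = s ''C'' (Suc i) - s ''C'' i)"
proof -
  define I where "I k s \<longleftrightarrow>
    (\<forall>x. x \<notin> {''C'', ''y'', ''c''} \<longrightarrow> s x = s0 x) \<and>
    s ''C'' 0 = s0 ''C'' 0 \<and> s ''y'' 0 = s0 ''y'' 0 \<and>
    (\<forall>i<k. s ''C'' (Suc i) = (s ''e'' i - s ''g'' i * s ''y'' i) / s ''D'' i \<and>
      s ''y'' (Suc i) = s ''y'' i + (s ''b'' (Suc i) - s ''b'' i) * s ''C'' (Suc i) \<and>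
      s ''c'' i = s ''C'' (Suc i) - s ''C'' i)" for k s
  have init: "I 0 s0"
    by (simp add: I_def)
  have step: "\<exists>s'. exec forward_step ((input_env n)(''k'' := k)) s = Some (s', 7) \<and> I (Suc k) s'"
    if "0 \<le> k" and k: "k < n + 1" and I: "I k s" for k s
  proof -
    have D: "s ''D'' k \<noteq> 0"
      using I k assms[of k] by (auto simp: I_def)
    define C where "C = (s ''e'' k - s ''g'' k * s ''y'' k) / s ''D'' k"
    define y where "y = s ''y'' k + (s ''b'' (Suc k) - s ''b'' k) * C"
    define s' where "s' = s(''C'' := (s ''C'')(Suc k := C), ''y'' := (s ''y'')(Suc k := y),
      ''c'' := (s ''c'')(k := C - s ''C'' k))"
    have "exec forward_step ((input_env n)(''k'' := k)) s = Some (s', 7)"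
      using D by (simp add: forward_step_def Let_def C_def[symmetric] y_def[symmetric] s'_def)
    moreover have "I (Suc k) s'"
      using I by (auto simp: I_def s'_def C_def y_def less_Suc_eq)
    ultimately show ?thesis
      by blast
  qed
  have "\<exists>s. iterate (\<lambda>k. exec forward_step ((input_env n)(''k'' := k))) [0..<n + 1] s0 =
      Some (s, 7 * (n + 1 - 0)) \<and> I (n + 1) s"
    by (rule iterate_upt_invariant[where I = I, OF init le0 step])
  then obtain s where "iterate (\<lambda>k. exec forward_step ((input_env n)(''k'' := k))) [0..<n + 1] s0 =
      Some (s, 7 * (n + 1))" "I (n + 1) s"
    unfolding minus_nat.diff_0 by blast
  then have "exec forward_sweep (input_env n) s0 = Some (s, 7 * (n + 1))"
    by (simp add: forward_sweep_def input_env_def del: upt_Suc)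
  with \<open>I (n + 1) s\<close> show ?thesis
    by (auto simp: I_def less_Suc_eq_le)
qed

section \<open>Reduction to element integrals\<close>

text \<open>An essentially bounded measurable function on a set of finite measure is integrable. The
  weight \<open>g\<close> is merely Lebesgue measurable, so the Borel factor \<open>h\<close> is
  first passed to the completion.\<close>

lemma L_infinity_set_integrable_mult:
  assumes g: "L_infinity unit_interval g" and h: "h \<in> borel_measurable borel"
    and K: "\<And>x. x \<in> unit_interval \<Longrightarrow> \<bar>h x\<bar> \<le> K"
  shows "set_integrable lebesgue unit_interval (\<lambda>x. g x * h x)"
proof -
  obtain K' where gm: "set_borel_measurable lebesgue unit_interval g"
    and K': "AE x\<in>unit_interval in lebesgue. \<bar>g x\<bar> \<le> K'"
    using g by (auto simp: L_infinity_def)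
  have hm: "h \<in> borel_measurable lebesgue"
    using h by (intro measurable_completion) simp
  have "AE x in lebesgue. x \<in> unit_interval \<longrightarrow>
      norm (indicator unit_interval x *\<^sub>R (g x * h x)) \<le> K' * K"
    using K'
  proof eventually_elim
    case (elim x)
    then show ?case
      using K[of x] mult_mono[of "\<bar>g x\<bar>" K' "\<bar>h x\<bar>" K] by (auto simp: abs_mult)
  qed
  moreover have "(\<lambda>x. (indicator unit_interval x *\<^sub>R g x) * h x) \<in> borel_measurable lebesgue"
    using gm hm unfolding set_borel_measurable_def by (rule borel_measurable_times)
  ultimately show ?thesis
    unfolding set_integrable_def
    by (intro integrableI_bounded_set[where A = unit_interval and B = "K' * K"])
       (auto simp: mult.assoc)
qed

lemma set_integral_partition:
  fixes b :: "nat \<Rightarrow> real" and g :: "real \<Rightarrow> real"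
  assumes "\<And>i. i < m \<Longrightarrow> b i \<le> b (Suc i)"
    and "set_integrable lebesgue {b 0<..<b m} g"
  shows "(LINT x:{b 0<..<b m}|lebesgue. g x) = (\<Sum>k<m. element_integral b k g)"
  using assms
proof (induction m)
  case 0
  then show ?case
    by (simp add: set_lebesgue_integral_def)
next
  case (Suc m)
  have "b 0 \<le> b j" if "j \<le> m" for j
    using that
  proof (induction j)
    case (Suc j)
    then show ?case
      using Suc.prems Suc.IH \<open>\<And>i. i < Suc m \<Longrightarrow> b i \<le> b (Suc i)\<close>[of j] by simp
  qed simp
  then have "b 0 \<le> b m" by simp
  have "b m \<le> b (Suc m)"
    by (simp add: Suc.prems(1))
  have left: "set_integrable lebesgue {b 0<..<b m} g"
    and right: "set_integrable lebesgue {b m<..<b (Suc m)} g"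
    using \<open>b 0 \<le> b m\<close> \<open>b m \<le> b (Suc m)\<close>
    by (auto intro!: set_integrable_subset[OF Suc.prems(2)])
  \<comment> \<open>The two open intervals miss at most the point \<open>b m\<close>, a null
    set.\<close>
  have "(LINT x:{b 0<..<b (Suc m)}|lebesgue. g x)
      = (LINT x:{b 0<..<b m} \<union> {b m<..<b (Suc m)}|lebesgue. g x)"
    using \<open>b 0 \<le> b m\<close> \<open>b m \<le> b (Suc m)\<close>
    by (intro set_integral_discrete_difference[where X = "{b m}"]) auto
  also have "\<dots> = (LINT x:{b 0<..<b m}|lebesgue. g x) + element_integral b m g"
    using set_integral_Un[OF _ left right] by (auto simp: element_integral_def)
  finally show ?case
    using Suc.IH left Suc.prems(1) by simp
qed

section \<open>Mesh geometry and weighted integrals over one element\<close>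

locale mesh =
  fixes n :: nat and b :: "nat \<Rightarrow> real"
  assumes b_first: "b 0 = 0" and b_less: "\<And>i. i \<le> n \<Longrightarrow> b i < b (Suc i)"
    and b_last: "b (Suc n) = 1"
begin

lemma b_mono: "i \<le> j \<Longrightarrow> j \<le> Suc n \<Longrightarrow> b i \<le> b j"
proof (induction rule: dec_induct)
  case (step j)
  then show ?case
    using b_less[of j] by simp
qed simp

lemma b_bounds: "i \<le> Suc n \<Longrightarrow> 0 \<le> b i" "i \<le> Suc n \<Longrightarrow> b i \<le> 1"
  using b_mono[of 0 i] b_mono[of i "Suc n"] by (auto simp: b_first b_last)

lemma element_subset: "k \<le> n \<Longrightarrow> {b k<..<b (Suc k)} \<subseteq> unit_interval"
  using b_bounds(1)[of k] b_bounds(2)[of "Suc k"] by auto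

lemma integral_eq_sum_elements:
  assumes "set_integrable lebesgue unit_interval g"
  shows "(LINT x:unit_interval|lebesgue. g x) = (\<Sum>k\<le>n. element_integral b k g)"
  using set_integral_partition[of "Suc n" b g] assms b_less
  by (simp add: b_first b_last less_Suc_eq_le less_imp_le lessThan_Suc_atMost)

lemma set_integrable_element:
  assumes "L_infinity unit_interval g" "k \<le> n" "continuous_on UNIV h"
  shows "set_integrable lebesgue {b k<..<b (Suc k)} (\<lambda>x. g x * h x)"
proof -
  have "compact (h ` {0..1})"
    using assms(3) by (intro compact_continuous_image continuous_on_subset[OF assms(3)]) auto
  then obtain K where K: "\<forall>x\<in>{0..1}. \<bar>h x\<bar> \<le> K"
    using compact_imp_bounded bounded_real by (metis image_eqI)
  have "set_integrable lebesgue unit_interval (\<lambda>x. g x * h x)"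
    using assms(1) borel_measurable_continuous_onI[OF assms(3)]
    by (rule L_infinity_set_integrable_mult[where K = K]) (use K in auto)
  then show ?thesis
    by (rule set_integrable_subset) (use element_subset assms(2) in auto)
qed

text \<open>Products of two functions affine on an element are quadratic there, so the three given
  moments of \<open>r\<close> determine every integral that occurs.\<close>

lemma element_integral_quadratic:
  assumes r: "L_infinity unit_interval r" and k: "k \<le> n"
  shows "element_integral b k (\<lambda>x. r x * (p + q * (x - b k) + w * (x - b k)\<^sup>2)) =
    p * element_integral b k r + q * element_integral b k (\<lambda>x. r x * (x - b k))
    + w * element_integral b k (\<lambda>x. r x * (x - b k)\<^sup>2)"
proof -
  have "set_integrable lebesgue {b k<..<b (Suc k)} (\<lambda>x. r x * 1)"
    "set_integrable lebesgue {b k<..<b (Suc k)} (\<lambda>x. r x * (x - b k))"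
    "set_integrable lebesgue {b k<..<b (Suc k)} (\<lambda>x. r x * (x - b k)\<^sup>2)"
    by (intro set_integrable_element r k continuous_intros)+
  moreover have "(\<lambda>x. r x * (p + q * (x - b k) + w * (x - b k)\<^sup>2)) =
      (\<lambda>x. (p * r x + q * (r x * (x - b k))) + w * (r x * (x - b k)\<^sup>2))"
    by (auto simp: algebra_simps)
  ultimately show ?thesis
    by (simp add: element_integral_def)
qed

text \<open>The form is the integral of \<open>r x * (y + z * (x - b k))^2\<close>. This supplies
  the semidefiniteness that the backward sweep needs.\<close>

lemma element_moments_nonneg:
  assumes r: "L_infinity unit_interval r" and k: "k \<le> n"
    and nonneg: "AE x\<in>unit_interval in lebesgue. r x \<ge> 0"
  shows "element_integral b k r * y\<^sup>2 + 2 * element_integral b k (\<lambda>x. r x * (x - b k)) * y * z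
    + element_integral b k (\<lambda>x. r x * (x - b k)\<^sup>2) * z\<^sup>2 \<ge> 0"
proof -
  have "0 \<le> element_integral b k (\<lambda>x. r x * (y + z * (x - b k))\<^sup>2)"
    unfolding element_integral_def set_lebesgue_integral_def
  proof (rule integral_nonneg_AE)
    show "AE x in lebesgue. 0 \<le> indicator {b k<..<b (k + 1)} x *\<^sub>R (r x * (y + z * (x - b k))\<^sup>2)"
      using nonneg
    proof eventually_elim
      case (elim x)
      then show ?case
        using element_subset[OF k] by (auto simp: indicator_def)
    qed
  qed
  also have "(\<lambda>x. r x * (y + z * (x - b k))\<^sup>2) =
      (\<lambda>x. r x * (y\<^sup>2 + (2 * y * z) * (x - b k) + z\<^sup>2 * (x - b k)\<^sup>2))"
    by (auto simp: power2_eq_square algebra_simps)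
  also have "element_integral b k \<dots> = y\<^sup>2 * element_integral b k r
      + (2 * y * z) * element_integral b k (\<lambda>x. r x * (x - b k))
      + z\<^sup>2 * element_integral b k (\<lambda>x. r x * (x - b k)\<^sup>2)"
    by (rule element_integral_quadratic[OF r k])
  finally show ?thesis
    by (simp add: mult_ac)
qed

text \<open>Comparison with the constant \<open>a\<^sub>0\<close> on an element of positive length.
  This keeps the pivots positive even where \<open>r\<close> vanishes.\<close>

lemma element_integral_pos:
  assumes a: "L_infinity unit_interval a" and k: "k \<le> n"
    and "a\<^sub>0 > 0" and bound: "AE x\<in>unit_interval in lebesgue. a x \<ge> a\<^sub>0"
  shows "element_integral b k a > 0"
proof -
  have "set_integrable lebesgue {b k<..<b (Suc k)} (\<lambda>x. a x * 1)"
    by (intro set_integrable_element a k continuous_intros)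
  moreover have "set_integrable lebesgue {b k<..<b (Suc k)} (\<lambda>x. a\<^sub>0)"
    unfolding set_integrable_def using b_less[OF k]
    by (intro integrable_scaleR_left integrable_real_indicator) auto
  moreover have "AE x\<in>{b k<..<b (Suc k)} in lebesgue. a\<^sub>0 \<le> a x"
    using bound element_subset[OF k] by (auto elim!: eventually_mono)
  ultimately have "(LINT x:{b k<..<b (Suc k)}|lebesgue. a\<^sub>0) \<le> element_integral b k a"
    unfolding element_integral_def by (simp add: set_integral_mono_AE)
  moreover have "(LINT x:{b k<..<b (Suc k)}|lebesgue. a\<^sub>0) = (b (Suc k) - b k) * a\<^sub>0"
    using b_less[OF k] by (simp add: set_lebesgue_integral_def)
  moreover have "(b (Suc k) - b k) * a\<^sub>0 > 0"
    using b_less[OF k] assms(3) by simp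
  ultimately show ?thesis
    by linarith
qed

section \<open>Matrix entries as sums over elements\<close>

lemma stiffness_entry:
  assumes a: "L_infinity unit_interval a" and "i \<le> n" "j \<le> n"
  shows "(LINT x:unit_interval|lebesgue. a x * heaviside (x - b i) * heaviside (x - b j)) =
    (\<Sum>k\<le>n. if i \<le> k \<and> j \<le> k then element_integral b k a else 0)"
proof -
  have "heaviside \<in> borel_measurable borel"
    unfolding heaviside_def[abs_def] by measurable
  then have "set_integrable lebesgue unit_interval (\<lambda>x. a x * (heaviside (x - b i) * heaviside (x - b j)))"
    by (intro L_infinity_set_integrable_mult[where K = 1] a) (auto simp: heaviside_def)
  then have "(LINT x:unit_interval|lebesgue. a x * heaviside (x - b i) * heaviside (x - b j)) =
      (\<Sum>k\<le>n. element_integral b k (\<lambda>x. a x * heaviside (x - b i) * heaviside (x - b j)))"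
    by (intro integral_eq_sum_elements) (simp add: mult.assoc)
  also have "\<dots> = (\<Sum>k\<le>n. if i \<le> k \<and> j \<le> k then element_integral b k a else 0)"
  proof (intro sum.cong refl)
    fix k assume "k \<in> {..n}"
    then have k: "k \<le> n" by simp
    \<comment> \<open>An open element contains no breakpoint, so the value 1/2 at the jump never
      occurs.\<close>
    have "heaviside (x - b l) = (if l \<le> k then 1 else 0)"
      if "x \<in> {b k<..<b (Suc k)}" "l \<le> n" for x l
    proof (cases "l \<le> k")
      case True
      then show ?thesis
        using that k b_mono[of l k] by (auto simp: heaviside_def)
    next
      case False
      then show ?thesis
        using that b_mono[of "Suc k" l] by (auto simp: heaviside_def)
    qed
    then have "element_integral b k (\<lambda>x. a x * heaviside (x - b i) * heaviside (x - b j)) =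
        element_integral b k (\<lambda>x. if i \<le> k \<and> j \<le> k then a x else 0)"
      unfolding element_integral_def using assms by (intro set_lebesgue_integral_cong) auto
    also have "\<dots> = (if i \<le> k \<and> j \<le> k then element_integral b k a else 0)"
      by (cases "i \<le> k"; cases "j \<le> k") (simp_all add: element_integral_def)
    finally show "element_integral b k (\<lambda>x. a x * heaviside (x - b i) * heaviside (x - b j)) =
        (if i \<le> k \<and> j \<le> k then element_integral b k a else 0)" .
  qed
  finally show ?thesis .
qed

lemma mass_entry:
  assumes r: "L_infinity unit_interval r" and "i \<le> n" "j \<le> n"
  shows "(LINT x:unit_interval|lebesgue. r x * relu (x - b i) * relu (x - b j)) =
    (\<Sum>k\<le>n. if i \<le> k \<and> j \<le> k then
      (b k - b i) * (b k - b j) * element_integral b k r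
      + ((b k - b i) + (b k - b j)) * element_integral b k (\<lambda>x. r x * (x - b k))
      + element_integral b k (\<lambda>x. r x * (x - b k)\<^sup>2) else 0)"
proof -
  have "relu \<in> borel_measurable borel"
    unfolding relu_def[abs_def] by measurable
  moreover have "\<bar>relu (x - b i) * relu (x - b j)\<bar> \<le> 1 * 1" if "x \<in> unit_interval" for x
    unfolding abs_mult
    using that b_bounds(1)[of i] b_bounds(1)[of j] assms by (intro mult_mono) (auto simp: relu_def)
  ultimately have "set_integrable lebesgue unit_interval (\<lambda>x. r x * (relu (x - b i) * relu (x - b j)))"
    by (intro L_infinity_set_integrable_mult[where K = 1] r) auto
  then have "(LINT x:unit_interval|lebesgue. r x * relu (x - b i) * relu (x - b j)) =
      (\<Sum>k\<le>n. element_integral b k (\<lambda>x. r x * relu (x - b i) * relu (x - b j)))"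
    by (intro integral_eq_sum_elements) (simp add: mult.assoc)
  also have "\<dots> = (\<Sum>k\<le>n. if i \<le> k \<and> j \<le> k then
      (b k - b i) * (b k - b j) * element_integral b k r
      + ((b k - b i) + (b k - b j)) * element_integral b k (\<lambda>x. r x * (x - b k))
      + element_integral b k (\<lambda>x. r x * (x - b k)\<^sup>2) else 0)"
    (is "_ = (\<Sum>k\<le>n. if i \<le> k \<and> j \<le> k then ?q k else 0)")
  proof (intro sum.cong refl)
    fix k assume "k \<in> {..n}"
    then have k: "k \<le> n" by simp
    \<comment> \<open>Expanding about the left endpoint \<open>b k\<close> turns the product into a
      quadratic in \<open>x - b k\<close>, matching the given moments.\<close>
    have "relu (x - b l) = (if l \<le> k then (x - b k) + (b k - b l) else 0)"
      if "x \<in> {b k<..<b (Suc k)}" "l \<le> n" for x l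
    proof (cases "l \<le> k")
      case True
      then show ?thesis
        using that k b_mono[of l k] by (auto simp: relu_def)
    next
      case False
      then show ?thesis
        using that b_mono[of "Suc k" l] by (auto simp: relu_def)
    qed
    then have "element_integral b k (\<lambda>x. r x * relu (x - b i) * relu (x - b j)) =
        element_integral b k (\<lambda>x. if i \<le> k \<and> j \<le> k then
          r x * ((b k - b i) * (b k - b j) + ((b k - b i) + (b k - b j)) * (x - b k) + 1 * (x - b k)\<^sup>2)
          else 0)"
      unfolding element_integral_def using assms
      by (intro set_lebesgue_integral_cong) (auto simp: power2_eq_square algebra_simps)
    also have "\<dots> = (if i \<le> k \<and> j \<le> k then ?q k else 0)"
    proof (cases "i \<le> k \<and> j \<le> k")
      case True
      then show ?thesis
        using element_integral_quadratic[OF r k, of "(b k - b i) * (b k - b j)"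
            "(b k - b i) + (b k - b j)" 1] by simp
    next
      case False
      then show ?thesis
        by (simp only: if_False) (simp add: element_integral_def)
    qed
    finally show "element_integral b k (\<lambda>x. r x * relu (x - b i) * relu (x - b j)) =
        (if i \<le> k \<and> j \<le> k then ?q k else 0)" .
  qed
  finally show ?thesis .
qed

lemma system_matrix_entry:
  assumes "L_infinity unit_interval a" "L_infinity unit_interval r" "i \<le> n" "j \<le> n"
  shows "system_matrix n b a r \<gamma> $$ (i, j) =
    (\<Sum>k\<le>n. if i \<le> k \<and> j \<le> k then
      element_integral b k a
      + (b k - b i) * (b k - b j) * element_integral b k r
      + ((b k - b i) + (b k - b j)) * element_integral b k (\<lambda>x. r x * (x - b k))
      + element_integral b k (\<lambda>x. r x * (x - b k)\<^sup>2) else 0)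
    + \<gamma> * ((1 - b i) * (1 - b j))"
  using assms
  by (simp add: system_matrix_def stiffness_matrix_def mass_matrix_def outer_product_def d_vector_def
      stiffness_entry mass_entry sum.distrib[symmetric])
     (intro sum.cong refl, auto)

end

section \<open>The sweeps solve the system\<close>

text \<open>The entries are affine in \<open>b k - b j\<close>, so an element sees the coefficients
  only through the slope \<open>S\<close> and the left nodal value \<open>y\<close>. This makes the
  dense rows local.\<close>

lemma elementwise_row_sum:
  fixes c b :: "nat \<Rightarrow> real" and S y A R0 R1 R2 :: real
  assumes k: "k \<le> n" and S: "S = (\<Sum>j\<le>k. c j)" and y: "y = (\<Sum>j\<le>k. c j * (b k - b j))"
  shows "(\<Sum>j\<le>n. (if i \<le> k \<and> j \<le> k then
      A + (b k - b i) * (b k - b j) * R0 + ((b k - b i) + (b k - b j)) * R1 + R2 else 0) * c j) =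
    (if i \<le> k then A * S + R1 * y + R2 * S + (b k - b i) * (R0 * y + R1 * S) else 0)"
proof (cases "i \<le> k")
  case True
  have "(\<Sum>j\<le>n. (if i \<le> k \<and> j \<le> k then
      A + (b k - b i) * (b k - b j) * R0 + ((b k - b i) + (b k - b j)) * R1 + R2 else 0) * c j) =
    (\<Sum>j\<le>k. (A + (b k - b i) * (b k - b j) * R0 + ((b k - b i) + (b k - b j)) * R1 + R2) * c j)"
    using True k by (intro sum.mono_neutral_cong_right) auto
  also have "\<dots> = (\<Sum>j\<le>k. (A + R2 + (b k - b i) * R1) * c j
      + (R1 + (b k - b i) * R0) * (c j * (b k - b j)))"
    by (intro sum.cong refl) (simp add: algebra_simps)
  also have "\<dots> = (A + R2 + (b k - b i) * R1) * S + (R1 + (b k - b i) * R0) * y"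
    by (simp add: S y sum.distrib sum_distrib_left)
  finally show ?thesis
    using True by (simp add: algebra_simps)
qed simp

text \<open>Undoes the subtraction of consecutive rows. Both sums are unrolled in one induction
  because the recurrence for \<open>F\<close> refers to \<open>\<mu>\<close>.\<close>

lemma backward_recurrence_solution:
  fixes F \<mu> Q G b :: "nat \<Rightarrow> real"
  assumes "\<And>k. k \<le> n \<Longrightarrow> \<mu> k = \<mu> (Suc k) + G k"
    and "\<And>k. k \<le> n \<Longrightarrow> F k = F (Suc k) + Q k + (b (Suc k) - b k) * \<mu> (Suc k)"
    and "F (Suc n) = 0" "i \<le> Suc n"
  shows "\<mu> i = (\<Sum>k=i..n. G k) + \<mu> (Suc n) \<and>
    F i = (\<Sum>k=i..n. Q k + (b k - b i) * G k) + (b (Suc n) - b i) * \<mu> (Suc n)"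
  using assms(4)
proof (induction rule: inc_induct)
  case base
  then show ?case
    using assms(3) by simp
next
  case (step i)
  \<comment> \<open>Moving the base point from \<open>b (Suc i)\<close> to \<open>b i\<close> adds
    the element length times the tail sum of \<open>G\<close>, which is the interior part of
    \<open>\<mu> (Suc i)\<close>.\<close>
  have "(\<Sum>k=Suc i..n. Q k + (b k - b i) * G k) =
      (\<Sum>k=Suc i..n. (Q k + (b k - b (Suc i)) * G k) + (b (Suc i) - b i) * G k)"
    by (intro sum.cong refl) (simp add: algebra_simps)
  also have "\<dots> = (\<Sum>k=Suc i..n. Q k + (b k - b (Suc i)) * G k)
      + (b (Suc i) - b i) * (\<Sum>k=Suc i..n. G k)"
    by (simp add: sum.distrib sum_distrib_left)
  finally show ?case
    using step assms(1)[of i] assms(2)[of i]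
    by (simp add: sum.atLeast_Suc_atMost[of i n] algebra_simps)
qed

text \<open>One elimination step, with \<open>s * (y + h * C) + t\<close> standing for \<mu> at the
  right end of the element. The choice of \<open>C\<close> satisfies the differenced row (second
  claim), and the ansatz with the updated coefficients then reproduces the balance for \<mu> (first
  claim).\<close>

lemma riccati_substitution:
  fixes A R0 R1 R2 h s t D g e y C \<phi> :: real
  assumes "D > 0" and D: "D = A + R2 + h * h * s" and g: "g = R1 + h * s" and e: "e = \<phi> - h * t"
    and C: "C = (e - g * y) / D"
  shows "(s + R0 - g * g / D) * y + (t + g * e / D) = (s * (y + h * C) + t) + (R0 * y + R1 * C)"
    and "\<phi> = (A * C + R1 * y + R2 * C) + h * (s * (y + h * C) + t)"
proof -
  have "(s + R0 - g * g / D) * y + (t + g * e / D) = s * y + R0 * y + t + g * C"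
    by (simp add: C algebra_simps diff_divide_distrib)
  also have "\<dots> = (s * (y + h * C) + t) + (R0 * y + R1 * C)"
    by (simp add: g algebra_simps)
  finally show "(s + R0 - g * g / D) * y + (t + g * e / D) = (s * (y + h * C) + t) + (R0 * y + R1 * C)" .
  have "D * C = e - g * y"
    using \<open>D > 0\<close> by (simp add: C)
  then show "\<phi> = (A * C + R1 * y + R2 * C) + h * (s * (y + h * C) + t)"
    by (simp add: D g e algebra_simps)
qed

text \<open>The local boundary value problem implies the dense system: its equations are summed back
  from the right end to row \<open>i\<close>. The index of \<open>S\<close> is shifted,
  \<open>S (Suc k)\<close> being the slope on element \<open>k\<close>.\<close>

lemma (in mesh) system_solution:
  fixes c y S \<mu> F :: "nat \<Rightarrow> real"
  assumes "L_infinity unit_interval a" "L_infinity unit_interval r"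
    and S0: "S 0 = 0" and y0: "y 0 = 0"
    and S: "\<And>k. k \<le> n \<Longrightarrow> c k = S (Suc k) - S k"
    and y: "\<And>k. k \<le> n \<Longrightarrow> y (Suc k) = y k + (b (Suc k) - b k) * S (Suc k)"
    and \<mu>: "\<And>k. k \<le> n \<Longrightarrow> \<mu> k = \<mu> (Suc k) +
      (element_integral b k r * y k + element_integral b k (\<lambda>x. r x * (x - b k)) * S (Suc k))"
    and F: "\<And>k. k \<le> n \<Longrightarrow> F k = F (Suc k) +
      (element_integral b k a * S (Suc k) + element_integral b k (\<lambda>x. r x * (x - b k)) * y k
       + element_integral b k (\<lambda>x. r x * (x - b k)\<^sup>2) * S (Suc k)) + (b (Suc k) - b k) * \<mu> (Suc k)"
    and \<mu>_last: "\<mu> (Suc n) = \<gamma> * y (Suc n)" and F_last: "F (Suc n) = 0"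
  shows "system_matrix n b a r \<gamma> *\<^sub>v Matrix.vec (n + 1) c = Matrix.vec (n + 1) F"
proof (rule eq_vecI)
  fix i assume "i < dim_vec (Matrix.vec (n + 1) F)"
  then have i: "i \<le> n" by simp
  have sum_c: "S (Suc k) = (\<Sum>j\<le>k. c j)" if "k \<le> n" for k
    using that by (induction k) (simp_all add: S S0)
  have nodal: "y k = (\<Sum>j<k. c j * (b k - b j))" if "k \<le> Suc n" for k
    using that
  proof (induction k)
    case (Suc k)
    have "(\<Sum>j<Suc k. c j * (b (Suc k) - b j)) =
        (\<Sum>j<Suc k. c j * (b k - b j) + (b (Suc k) - b k) * c j)"
      by (intro sum.cong refl) (simp add: algebra_simps)
    also have "\<dots> = (\<Sum>j<k. c j * (b k - b j)) + (b (Suc k) - b k) * (\<Sum>j\<le>k. c j)"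
      by (simp add: sum.distrib sum_distrib_left[symmetric] distrib_left lessThan_Suc_atMost[symmetric])
    finally show ?case
      using Suc y sum_c by simp
  qed (simp add: y0)
  define Q where "Q k = element_integral b k a * S (Suc k)
    + element_integral b k (\<lambda>x. r x * (x - b k)) * y k
    + element_integral b k (\<lambda>x. r x * (x - b k)\<^sup>2) * S (Suc k)" for k
  define G where "G k = element_integral b k r * y k
    + element_integral b k (\<lambda>x. r x * (x - b k)) * S (Suc k)" for k
  define E where "E k j = (if i \<le> k \<and> j \<le> k then
      element_integral b k a
      + (b k - b i) * (b k - b j) * element_integral b k r
      + ((b k - b i) + (b k - b j)) * element_integral b k (\<lambda>x. r x * (x - b k))
      + element_integral b k (\<lambda>x. r x * (x - b k)\<^sup>2) else 0)" for k j
  \<comment> \<open>The sum in \<open>nodal\<close> stops before \<open>k\<close>; the extra term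
    \<open>j = k\<close> required here carries the factor \<open>b k - b k = 0\<close>.\<close>
  have row: "(\<Sum>j\<le>n. E k j * c j) = (if i \<le> k then Q k + (b k - b i) * G k else 0)" if "k \<le> n" for k
    unfolding E_def Q_def G_def
    by (rule elementwise_row_sum[OF that sum_c[OF that]])
       (use nodal[of k] that in \<open>simp add: lessThan_Suc_atMost[symmetric]\<close>)
  have dims: "dim_row (system_matrix n b a r \<gamma>) = Suc n" "dim_col (system_matrix n b a r \<gamma>) = Suc n"
    by (simp_all add: system_matrix_def outer_product_def d_vector_def)
  have "(system_matrix n b a r \<gamma> *\<^sub>v Matrix.vec (n + 1) c) $ i =
      (\<Sum>j\<le>n. system_matrix n b a r \<gamma> $$ (i, j) * c j)"
    using i dims by (simp add: scalar_prod_def atLeast0LessThan lessThan_Suc_atMost)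
  also have "\<dots> = (\<Sum>j\<le>n. (\<Sum>k\<le>n. E k j * c j) + \<gamma> * ((1 - b i) * (c j * (1 - b j))))"
  proof (intro sum.cong refl)
    fix j assume "j \<in> {..n}"
    then have "system_matrix n b a r \<gamma> $$ (i, j) = (\<Sum>k\<le>n. E k j) + \<gamma> * ((1 - b i) * (1 - b j))"
      unfolding E_def using assms(1,2) i by (intro system_matrix_entry) auto
    then show "system_matrix n b a r \<gamma> $$ (i, j) * c j =
        (\<Sum>k\<le>n. E k j * c j) + \<gamma> * ((1 - b i) * (c j * (1 - b j)))"
      by (simp add: sum_distrib_right distrib_right)
  qed
  also have "\<dots> = (\<Sum>k\<le>n. \<Sum>j\<le>n. E k j * c j) + \<gamma> * ((1 - b i) * (\<Sum>j\<le>n. c j * (1 - b j)))"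
    by (simp add: sum.distrib sum_distrib_left sum.swap[of "\<lambda>k j. E k j * c j"])
  also have "(\<Sum>k\<le>n. \<Sum>j\<le>n. E k j * c j) = (\<Sum>k=i..n. Q k + (b k - b i) * G k)"
    using i by (simp add: row) (intro sum.mono_neutral_cong_right, auto)
  \<comment> \<open>The dense rank-one penalty acts only through the endpoint value u(1).\<close>
  also have "(\<Sum>j\<le>n. c j * (1 - b j)) = y (Suc n)"
    by (simp add: nodal b_last lessThan_Suc_atMost)
  \<comment> \<open>By the terminal condition on \<open>\<mu>\<close>, the penalty term is the
    boundary term of the unrolled recurrence.\<close>
  also have "(\<Sum>k=i..n. Q k + (b k - b i) * G k) + \<gamma> * ((1 - b i) * y (Suc n)) = F i"
    using backward_recurrence_solution[of n \<mu> G F Q b i] \<mu> F F_last \<mu>_last i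
    by (simp add: Q_def G_def b_last)
  finally show "(system_matrix n b a r \<gamma> *\<^sub>v Matrix.vec (n + 1) c) $ i = Matrix.vec (n + 1) F $ i"
    using i by simp
qed (simp add: system_matrix_def outer_product_def d_vector_def)

section \<open>Correctness and operation count of the program\<close>

lemma (in mesh) exec_sweeps_solves:
  assumes a: "L_infinity unit_interval a" and r: "L_infinity unit_interval r"
    and "a\<^sub>0 > 0" "AE x\<in>unit_interval in lebesgue. a x \<ge> a\<^sub>0"
    and "AE x\<in>unit_interval in lebesgue. r x \<ge> 0" "\<gamma> \<ge> 0" and F: "F \<in> carrier_vec (n + 1)"
  shows "\<exists>s. exec (Seq backward_sweep forward_sweep) (input_env n) (input_store n b a r \<gamma> F) =
      Some (s, 27 * (n + 1)) \<and> system_matrix n b a r \<gamma> *\<^sub>v output_vector n s = F"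
proof -
  define s0 where "s0 = input_store n b a r \<gamma> F"
  have data: "s0 ''b'' i = b i" "s0 ''a'' i = element_integral b i a" "s0 ''r0'' i = element_integral b i r"
    "s0 ''r1'' i = element_integral b i (\<lambda>x. r x * (x - b i))"
    "s0 ''r2'' i = element_integral b i (\<lambda>x. r x * (x - b i)\<^sup>2)" "s0 ''b'' (Suc i) = b (Suc i)"
    if "i \<le> n" for i
    using that by (simp_all add: s0_def input_store_def)
  \<comment> \<open>Cells outside the input hold 0, which provides the boundary data. The zero in
    \<open>F\<close> is the row of \<sigma>(x - 1), a function vanishing on the interval.\<close>
  have zeros: "s0 ''t'' (Suc n) = 0" "s0 ''C'' 0 = 0" "s0 ''y'' 0 = 0" "s0 ''F'' (Suc n) = 0"
    and \<gamma>: "s0 ''gamma'' 0 = \<gamma>"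
    by (simp_all add: s0_def input_store_def)
  obtain s1 where s1: "exec backward_sweep (input_env n) s0 = Some (s1, 20 * (n + 1))"
    and s1_eq: "\<forall>x \<in> {''b'', ''F'', ''a'', ''r0'', ''r1'', ''r2'', ''y'', ''C''}. s1 x = s0 x"
    and s1_last: "s1 ''s'' (n + 1) = \<gamma>" "s1 ''t'' (n + 1) = 0"
    and riccati: "\<And>i. i \<le> n \<Longrightarrow> riccati_relations s1 i"
    using exec_backward_sweep[of n s0] element_integral_pos[OF a] element_moments_nonneg[OF r]
      assms(3-6) by (auto simp: data zeros \<gamma>)
  have D_pos: "s1 ''D'' i > 0" if "i \<le> n" for i
    using riccati[OF that] by (simp add: riccati_relations_def Let_def)
  obtain s2 where s2: "exec forward_sweep (input_env n) s1 = Some (s2, 7 * (n + 1))"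
    and s2_eq: "\<forall>x. x \<notin> {''C'', ''y'', ''c''} \<longrightarrow> s2 x = s1 x"
    and "s2 ''C'' 0 = s1 ''C'' 0" "s2 ''y'' 0 = s1 ''y'' 0"
    and step: "\<And>i. i \<le> n \<Longrightarrow> s2 ''C'' (Suc i) = (s2 ''e'' i - s2 ''g'' i * s2 ''y'' i) / s2 ''D'' i \<and>
      s2 ''y'' (Suc i) = s2 ''y'' i + (s2 ''b'' (Suc i) - s2 ''b'' i) * s2 ''C'' (Suc i) \<and>
      s2 ''c'' i = s2 ''C'' (Suc i) - s2 ''C'' i"
    using exec_forward_sweep[of n s1, OF D_pos] by blast
  then have s2_first: "s2 ''C'' 0 = 0" "s2 ''y'' 0 = 0"
    by (simp_all add: s1_eq zeros)
  \<comment> \<open>The ansatz read backwards: \<mu> is never computed by the program but assembled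
    from the coefficients of the first sweep and the nodal values of the second.\<close>
  define \<mu> where "\<mu> i = s1 ''s'' i * s2 ''y'' i + s1 ''t'' i" for i
  have y: "s2 ''y'' (Suc k) = s2 ''y'' k + (b (Suc k) - b k) * s2 ''C'' (Suc k)" if "k \<le> n" for k
    using step[OF that] that by (simp add: s2_eq s1_eq data)
  have \<mu>: "\<mu> k = \<mu> (Suc k) + (element_integral b k r * s2 ''y'' k
        + element_integral b k (\<lambda>x. r x * (x - b k)) * s2 ''C'' (Suc k))"
    and F_step: "s0 ''F'' k = s0 ''F'' (Suc k) + (element_integral b k a * s2 ''C'' (Suc k)
        + element_integral b k (\<lambda>x. r x * (x - b k)) * s2 ''y'' k
        + element_integral b k (\<lambda>x. r x * (x - b k)\<^sup>2) * s2 ''C'' (Suc k))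
        + (b (Suc k) - b k) * \<mu> (Suc k)" if k: "k \<le> n" for k
  proof -
    have D: "s1 ''D'' k = element_integral b k a + element_integral b k (\<lambda>x. r x * (x - b k)\<^sup>2)
        + (b (Suc k) - b k) * (b (Suc k) - b k) * s1 ''s'' (Suc k)"
      and g: "s1 ''g'' k = element_integral b k (\<lambda>x. r x * (x - b k)) + (b (Suc k) - b k) * s1 ''s'' (Suc k)"
      and e: "s1 ''e'' k = (s0 ''F'' k - s0 ''F'' (Suc k)) - (b (Suc k) - b k) * s1 ''t'' (Suc k)"
      and s: "s1 ''s'' k = s1 ''s'' (Suc k) + element_integral b k r - s1 ''g'' k * s1 ''g'' k / s1 ''D'' k"
      and t: "s1 ''t'' k = s1 ''t'' (Suc k) + s1 ''g'' k * s1 ''e'' k / s1 ''D'' k"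
      using riccati[OF k] k by (simp_all add: riccati_relations_def Let_def s1_eq data)
    have C: "s2 ''C'' (Suc k) = (s1 ''e'' k - s1 ''g'' k * s2 ''y'' k) / s1 ''D'' k"
      using step[OF k] by (simp add: s2_eq)
    note substituted = riccati_substitution[OF D_pos[OF k] D g e C]
    show "\<mu> k = \<mu> (Suc k) + (element_integral b k r * s2 ''y'' k
        + element_integral b k (\<lambda>x. r x * (x - b k)) * s2 ''C'' (Suc k))"
      unfolding \<mu>_def y[OF k] s t by (rule substituted(1))
    show "s0 ''F'' k = s0 ''F'' (Suc k) + (element_integral b k a * s2 ''C'' (Suc k)
        + element_integral b k (\<lambda>x. r x * (x - b k)) * s2 ''y'' k
        + element_integral b k (\<lambda>x. r x * (x - b k)\<^sup>2) * s2 ''C'' (Suc k))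
        + (b (Suc k) - b k) * \<mu> (Suc k)"
      using substituted(2) unfolding \<mu>_def y[OF k] by linarith
  qed
  have "system_matrix n b a r \<gamma> *\<^sub>v Matrix.vec (n + 1) (s2 ''c'') = Matrix.vec (n + 1) (s0 ''F'')"
  proof (rule system_solution[where S = "s2 ''C''" and y = "s2 ''y''" and \<mu> = \<mu>])
    show "\<mu> (Suc n) = \<gamma> * s2 ''y'' (Suc n)"
      using s1_last by (simp add: \<mu>_def)
  qed (fact a r s2_first zeros y \<mu> F_step | simp add: step)+
  moreover have "Matrix.vec (n + 1) (s0 ''F'') = F"
    using F by (intro eq_vecI) (auto simp: s0_def input_store_def)
  ultimately show ?thesis
    using s1 s2 by (simp add: s0_def output_vector_def)
qed

theorem mainTheorem4:
  shows "\<exists>(P :: cmd) (C :: real).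
    \<forall>(n :: nat) (b :: nat \<Rightarrow> real) (a :: real \<Rightarrow> real) (r :: real \<Rightarrow> real) (f :: real \<Rightarrow> real)
      (a\<^sub>0 :: real) (r\<^sub>0 :: real) (\<gamma> :: real) (\<alpha> :: real) (\<beta> :: real).
      n \<ge> 1 \<longrightarrow>
      b 0 = 0 \<longrightarrow> (\<forall>i\<le>n. b i < b (i+1)) \<longrightarrow> b (n+1) = 1 \<longrightarrow>
      L_infinity unit_interval a \<longrightarrow> L_infinity unit_interval r \<longrightarrow>
      a\<^sub>0 > 0 \<longrightarrow> (AE x\<in>unit_interval in lebesgue. a x \<ge> a\<^sub>0) \<longrightarrow>
      r\<^sub>0 \<ge> 0 \<longrightarrow> (AE x\<in>unit_interval in lebesgue. r x \<ge> r\<^sub>0) \<longrightarrow>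
      \<gamma> > 0 \<longrightarrow>
      (\<exists>(s :: store) (t :: nat).
         exec P (input_env n) (input_store n b a r \<gamma> (system_rhs n b r f \<gamma> \<alpha> \<beta>)) = Some (s, t) \<and>
         real t \<le> C * real n \<and>
         system_matrix n b a r \<gamma> *\<^sub>v output_vector n s = system_rhs n b r f \<gamma> \<alpha> \<beta>)"
\<comment> \<open>Per element, 20 operations backward and 7 forward give \<open>27 * (n + 1)\<close>
  in total, at most \<open>54 * n\<close> since \<open>n \<ge> 1\<close>.\<close>
proof (intro exI[of _ "Seq backward_sweep forward_sweep"] exI[of _ "54 :: real"] allI impI)
  fix n :: nat and b a r f :: "_ \<Rightarrow> real" and a\<^sub>0 r\<^sub>0 \<gamma> \<alpha> \<beta> :: real
  assume n: "n \<ge> 1" and b: "b 0 = 0" "\<forall>i\<le>n. b i < b (i+1)" "b (n+1) = 1"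
    and a: "L_infinity unit_interval a" and r: "L_infinity unit_interval r"
    and a\<^sub>0: "a\<^sub>0 > 0" "AE x\<in>unit_interval in lebesgue. a x \<ge> a\<^sub>0"
    and r\<^sub>0: "r\<^sub>0 \<ge> 0" "AE x\<in>unit_interval in lebesgue. r x \<ge> r\<^sub>0"
    and \<gamma>: "\<gamma> > 0"
  interpret mesh n b
    using b by unfold_locales auto
  have "AE x\<in>unit_interval in lebesgue. r x \<ge> 0"
    using r\<^sub>0(2) by eventually_elim (use r\<^sub>0(1) in auto)
  moreover have "system_rhs n b r f \<gamma> \<alpha> \<beta> \<in> carrier_vec (n + 1)"
    by (simp add: system_rhs_def load_vector_def d_vector_def)
  ultimately obtain s where "exec (Seq backward_sweep forward_sweep) (input_env n)
      (input_store n b a r \<gamma> (system_rhs n b r f \<gamma> \<alpha> \<beta>)) = Some (s, 27 * (n + 1))"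
    "system_matrix n b a r \<gamma> *\<^sub>v output_vector n s = system_rhs n b r f \<gamma> \<alpha> \<beta>"
    using exec_sweeps_solves[OF a r a\<^sub>0 _ less_imp_le[OF \<gamma>]] by blast
  moreover have "real (27 * (n + 1)) \<le> 54 * real n"
    using n by simp
  ultimately show "\<exists>s t. exec (Seq backward_sweep forward_sweep) (input_env n)
      (input_store n b a r \<gamma> (system_rhs n b r f \<gamma> \<alpha> \<beta>)) = Some (s, t) \<and>
      real t \<le> 54 * real n \<and>
      system_matrix n b a r \<gamma> *\<^sub>v output_vector n s = system_rhs n b r f \<gamma> \<alpha> \<beta>"
    by blast
qed

end
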